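(* Let $c$ be any positive integer constant. Then there is a constant $C>0$ (depending only on $c$) such that for every $n$ and every $1\leq k\leq n\log^c n$ there is some $D=D(n,k,c)$ such that the following holds: for any deterministic exploration strategy with $k$ agents, there exists a rooted tree $T$ on $n$ vertices and of height $D$ on which the strategy needs at least \[ C\cdot\frac{\log k}{\log\log k}\cdot\Big(\frac{n}{k}+D\Big) \] rounds (i.e. the number of rounds is $\Omega\big(\frac{\log k}{\log\log k}(n/k+D)\big)$).
   Context: Collaborative tree exploration: a rooted tree $T$ is initially unknown. A team of $k$ agents all start at the root. Time proceeds in synchronous rounds; in each round every agent either stays at its current vertex or moves along an edge incident to its current vertex. The edges incident to a vertex (and hence its neighbours) are revealed when that vertex is visited by some agent for the first time. Agents may communicate globally at all times and have unlimited memory and computational power; an exploration strategy is deterministic. Exploration is complete once every vertex of $T$ has been visited by some agent; a strategy "needs at least $t$ rounds" on $T$ if it has not completed exploration of $T$ before round $t$. The height of a rooted tree is the maximum distance from the root to a vertex. $\log$ denotes the natural logarithm. *)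

theory Defs
  imports Complex_Main
begin

text \<open>
  Rooted trees are finite simple undirected graphs that are connected and acyclic, with a
  distinguished vertex. The edge set is a symmetric irreflexive relation, so that distances and
  connectivity can use powers and closures of relations.
\<close>

record 'v rooted_graph =
  verts :: "'v set"
  edges :: "'v rel"
  root :: 'v

definition cycle :: "'v rel \<Rightarrow> 'v list \<Rightarrow> bool" where
  "cycle E p \<longleftrightarrow> 3 \<le> length p \<and> distinct p \<and>
     (\<forall>i<length p. (p ! i, p ! (Suc i mod length p)) \<in> E)"

definition rooted_tree :: "'v rooted_graph \<Rightarrow> bool" where
  "rooted_tree T \<longleftrightarrow>
     finite (verts T) \<and> root T \<in> verts T \<and>
     edges T \<subseteq> verts T \<times> verts T \<and> sym (edges T) \<and> irrefl (edges T) \<and>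
     (\<forall>u\<in>verts T. \<forall>v\<in>verts T. (u, v) \<in> (edges T)\<^sup>*) \<and>
     \<not> (\<exists>p. cycle (edges T) p)"

definition graph_dist :: "'v rooted_graph \<Rightarrow> 'v \<Rightarrow> 'v \<Rightarrow> nat" where
  "graph_dist T u v = (LEAST d. (u, v) \<in> edges T ^^ d)"

definition height :: "'v rooted_graph \<Rightarrow> nat" where
  "height T = Max (graph_dist T (root T) ` verts T)"

text \<open>
  The agents are \<open>0, \<dots>, k - 1\<close>, and a configuration assigns to each agent its position; its
  values at \<open>i \<ge> k\<close> have no meaning. A deterministic strategy with global communication and
  unlimited memory is a function that computes the next configuration from everything known to
  the team: all configurations so far, most recent first, and all edges revealed so far. (The
  edges known at any earlier round can be recovered from these two arguments.)

  Vertices carry names that a strategy may use arbitrarily. Strategies that do not use the names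
  are a special case, and the names are part of the tree, so a lower bound that holds for some
  tree against each strategy is not affected by them.
\<close>

type_synonym 'v config = "nat \<Rightarrow> 'v"
type_synonym 'v strategy = "'v config list \<Rightarrow> 'v rel \<Rightarrow> 'v config"

text \<open>
  Every agent stays or moves along an edge. All edges at the current position of an agent are
  revealed, so it suffices to refer to the revealed edges. The condition also speaks about
  arguments that do not arise from any tree; this excludes no behaviour, because staying is
  always allowed.
\<close>

definition exploration_strategy :: "nat \<Rightarrow> 'v strategy \<Rightarrow> bool" where
  "exploration_strategy k S \<longleftrightarrow>
     (\<forall>h R i. h \<noteq> [] \<and> i < k \<longrightarrow> S h R i = hd h i \<or> (hd h i, S h R i) \<in> R)"

definition visited :: "nat \<Rightarrow> 'v config list \<Rightarrow> 'v set" where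
  "visited k h = {x i | x i. x \<in> set h \<and> i < k}"

definition revealed :: "'v rooted_graph \<Rightarrow> 'v set \<Rightarrow> 'v rel" where
  "revealed T X = {(u, v) \<in> edges T. u \<in> X \<or> v \<in> X}"

text \<open>\<open>run k S T t\<close> is the history of configurations after \<open>t\<close> rounds, most recent first.\<close>

primrec run :: "nat \<Rightarrow> 'v strategy \<Rightarrow> 'v rooted_graph \<Rightarrow> nat \<Rightarrow> 'v config list" where
  "run k S T 0 = [\<lambda>_. root T]"
| "run k S T (Suc t) =
     (let h = run k S T t in S h (revealed T (visited k h)) # h)"

definition explored_after :: "nat \<Rightarrow> 'v strategy \<Rightarrow> 'v rooted_graph \<Rightarrow> nat \<Rightarrow> bool" where
  "explored_after k S T t \<longleftrightarrow> verts T \<subseteq> visited k (run k S T t)"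

definition needs_at_least_rounds ::
    "nat \<Rightarrow> 'v strategy \<Rightarrow> 'v rooted_graph \<Rightarrow> real \<Rightarrow> bool" where
  "needs_at_least_rounds k S T t \<longleftrightarrow> (\<forall>s. real s < t \<longrightarrow> \<not> explored_after k S T s)"

end

theory Submission
  imports Defs "HOL-Real_Asymp.Real_Asymp"
begin

text \<open>
  An adaptive adversary plays against the strategy in phases of \<open>H\<close> rounds. It starts with
  \<open>q\<^sup>P\<close> paths of length \<open>H\<close> joined at the root (and further leaves at the
  root that adjust the number of vertices). At the start of a phase every live branch has a leaf at depth
  at least \<open>H\<close> that no agent has visited. The adversary keeps the fraction
  \<open>1/q\<close> of the live branches in which few agents are located, at most \<open>b\<close> each,
  and attaches \<open>H b + 1\<close> children to their hidden leaves. Agents that are outside a branch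
  cannot reach these children in the current phase, and those inside can visit at most \<open>H b\<close>
  of them, so a hidden leaf survives in every kept branch. Since \<open>b\<close> is at most
  \<open>2 k\<close> divided by the number of live branches, the attached children are about
  \<open>2 k H P / q\<close> in total. Thus \<open>P\<close> phases are possible, and they take \<open>P H\<close> rounds
  on a tree of height \<open>H + P\<close>. With \<open>q\<close> a power of \<open>log k\<close> and
  \<open>H\<close> about \<open>n/k + log k\<close>, the number of phases can be as large as
  \<open>P \<approx> log k / log q\<close>. For bounded \<open>k\<close> a path suffices.
\<close>

section \<open>Trees given by parent functions\<close>

text \<open>The adversary attaches leaves by extending \<open>par\<close> to fresh numbers; earlier
  vertices keep their names and parents.\<close>

definition parent_graph :: "nat \<Rightarrow> (nat \<Rightarrow> nat) \<Rightarrow> nat rooted_graph" where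
  "parent_graph N par = \<lparr>verts = {..<N},
     edges = {(u, v). u < N \<and> v < N \<and> (0 < v \<and> u = par v \<or> 0 < u \<and> v = par u)}, root = 0\<rparr>"

lemma parent_graph_simps [simp]:
  "verts (parent_graph N par) = {..<N}"
  "root (parent_graph N par) = 0"
  "(u, v) \<in> edges (parent_graph N par) \<longleftrightarrow>
     u < N \<and> v < N \<and> (0 < v \<and> u = par v \<or> 0 < u \<and> v = par u)"
  by (auto simp: parent_graph_def)

text \<open>\<open>dep\<close> witnesses that following parents ends at the root, and turns out to
  be the distance from it.\<close>

definition depth_labelling :: "nat \<Rightarrow> (nat \<Rightarrow> nat) \<Rightarrow> (nat \<Rightarrow> nat) \<Rightarrow> bool" where
  "depth_labelling N par dep \<longleftrightarrow> 0 < N \<and> dep 0 = 0 \<and>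
     (\<forall>v. 0 < v \<and> v < N \<longrightarrow> par v < N \<and> dep v = Suc (dep (par v)))"

text \<open>Labels change only across edges at the root. Several children of the root may share a
  label.\<close>

definition branch_labelling :: "nat \<Rightarrow> (nat \<Rightarrow> nat) \<Rightarrow> (nat \<Rightarrow> nat) \<Rightarrow> bool" where
  "branch_labelling N par br \<longleftrightarrow>
     (\<forall>v. 0 < v \<and> v < N \<and> par v \<noteq> 0 \<longrightarrow> br v = br (par v))"

lemma depth_labellingD:
  assumes "depth_labelling N par dep"
  shows "0 < N" "dep 0 = 0"
    "0 < v \<Longrightarrow> v < N \<Longrightarrow> par v < N"
    "0 < v \<Longrightarrow> v < N \<Longrightarrow> dep v = Suc (dep (par v))"
  using assms by (auto simp: depth_labelling_def)

lemma acyclic_parent_graph: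
  assumes "depth_labelling N par dep"
  shows "\<not> cycle (edges (parent_graph N par)) p"
proof
  assume c: "cycle (edges (parent_graph N par)) p"
  define n where "n = length p"
  have n: "3 \<le> n" and dist: "distinct p"
    and E: "\<And>i. i < n \<Longrightarrow> (p ! i, p ! (Suc i mod n)) \<in> edges (parent_graph N par)"
    using c by (auto simp: cycle_def n_def)
  \<comment> \<open>Both neighbours of a deepest vertex of the cycle are its parent.\<close>
  have "finite {..<n}" "{..<n} \<noteq> {}" using n by (auto simp: lessThan_empty_iff)
  then obtain i where i: "i < n" and max: "\<And>j. j < n \<Longrightarrow> dep (p ! j) \<le> dep (p ! i)"
    using Max_in[of "(\<lambda>j. dep (p ! j)) ` {..<n}"] Max_ge[of "(\<lambda>j. dep (p ! j)) ` {..<n}"]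
    by (smt (verit, best) finite_imageI image_iff image_is_empty lessThan_iff)
  have up: "v = par u" if "(u, v) \<in> edges (parent_graph N par) \<or> (v, u) \<in> edges (parent_graph N par)"
    "dep v \<le> dep u" for u v
    using that depth_labellingD[OF assms] by fastforce
  define j where "j = (if i = 0 then n - 1 else i - 1)"
  have j: "j < n" "Suc j mod n = i" using i n by (auto simp: j_def)
  define l where "l = Suc i mod n"
  have l: "l < n" using n by (auto simp: l_def)
  have "p ! l = par (p ! i)" using up[of "p ! i" "p ! l"] E[OF i, folded l_def] max[OF l] by blast
  moreover have "p ! j = par (p ! i)" using up[of "p ! i" "p ! j"] E[OF j(1), unfolded j(2)] max[OF j(1)]
    by blast
  ultimately have "l = j" using dist j(1) l by (metis n_def nth_eq_iff_index_eq)
  \<comment> \<open>Length at least 3 separates the cyclic successor \<open>l\<close> of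
    \<open>i\<close> from its predecessor \<open>j\<close>.\<close>
  moreover have "l \<noteq> j" using i n
    by (cases "Suc i = n") (auto simp: l_def j_def split: if_splits)
  ultimately show False by simp
qed

lemma dist_parent_graph:
  assumes "depth_labelling N par dep" "v < N"
  shows "(0, v) \<in> edges (parent_graph N par) ^^ dep v"
  using assms(2)
proof (induction "dep v" arbitrary: v)
  case 0
  then show ?case using depth_labellingD[OF assms(1)] by (cases "v = 0") auto
next
  case (Suc d)
  have v: "0 < v" using Suc.hyps(2) depth_labellingD(2)[OF assms(1)] by (cases "v = 0") auto
  have p: "par v < N" "dep v = Suc (dep (par v))"
    using depth_labellingD(3,4)[OF assms(1) v Suc.prems] .
  then have "(0, par v) \<in> edges (parent_graph N par) ^^ dep (par v)" using Suc.hyps by simp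
  moreover have "(par v, v) \<in> edges (parent_graph N par)" using p v Suc.prems by simp
  ultimately show ?case using p by auto
qed

text \<open>Edges change \<open>dep\<close> by one, so no walk from the root is shorter than the one
  in \<open>dist_parent_graph\<close>.\<close>

lemma dep_le_relpow:
  assumes "depth_labelling N par dep" "(u, v) \<in> edges (parent_graph N par) ^^ d"
  shows "dep v \<le> dep u + d"
  using assms(2)
proof (induction d arbitrary: v)
  case 0
  then show ?case by simp
next
  case (Suc d)
  then obtain x where x: "(u, x) \<in> edges (parent_graph N par) ^^ d"
    "(x, v) \<in> edges (parent_graph N par)" by auto
  then have "dep v \<le> Suc (dep x)" using depth_labellingD(4)[OF assms(1)] by fastforce
  with Suc.IH[OF x(1)] show ?case by simp
qed

lemma graph_dist_parent_graph:
  assumes "depth_labelling N par dep" "v < N"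
  shows "graph_dist (parent_graph N par) 0 v = dep v"
  unfolding graph_dist_def
  using dist_parent_graph[OF assms] dep_le_relpow[OF assms(1), of 0 v] depth_labellingD(2)[OF assms(1)]
  by (intro Least_equality) auto

lemma height_parent_graph:
  assumes "depth_labelling N par dep" "\<And>v. v < N \<Longrightarrow> dep v \<le> d" "w < N" "dep w = d"
  shows "height (parent_graph N par) = d"
proof -
  have "graph_dist (parent_graph N par) 0 ` {..<N} = dep ` {..<N}"
    using graph_dist_parent_graph[OF assms(1)] by (intro image_cong) auto
  moreover have "Max (dep ` {..<N}) = d" using assms(2-4) by (intro Max_eqI) auto
  ultimately show ?thesis by (simp add: height_def)
qed

lemma rooted_tree_parent_graph:
  assumes "depth_labelling N par dep"
  shows "rooted_tree (parent_graph N par)"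
proof -
  let ?E = "edges (parent_graph N par)"
  have s: "sym ?E" by (auto intro: symI)
  have i: "irrefl ?E"
  proof (rule irreflI)
    show "(u, u) \<notin> ?E" for u
      using depth_labellingD(4)[OF assms, of u] by (metis n_not_Suc_n parent_graph_simps(3))
  qed
  have r: "(0, v) \<in> ?E\<^sup>*" if "v < N" for v
    using dist_parent_graph[OF assms that] by (rule relpow_imp_rtrancl)
  have "(u, v) \<in> ?E\<^sup>*" if "u < N" "v < N" for u v
    using symD[OF sym_rtrancl[OF s] r[OF that(1)]] r[OF that(2)] by (rule rtrancl_trans)
  moreover have "?E \<subseteq> {..<N} \<times> {..<N}" by (auto simp: parent_graph_def)
  ultimately show ?thesis
    using s i acyclic_parent_graph[OF assms] depth_labellingD(1)[OF assms]
    by (auto simp: rooted_tree_def)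
qed

section \<open>Runs of a strategy and what the team can know\<close>

definition position :: "nat \<Rightarrow> 'v strategy \<Rightarrow> 'v rooted_graph \<Rightarrow> nat \<Rightarrow> 'v config" where
  "position k S T t = hd (run k S T t)"

lemma set_run: "set (run k S T t) = position k S T ` {..t}"
proof (induction t)
  case (Suc t)
  have "set (run k S T (Suc t)) = insert (position k S T (Suc t)) (set (run k S T t))"
    by (simp add: position_def Let_def)
  then show ?case using Suc.IH by (simp add: atMost_Suc)
qed (simp add: position_def)

lemma visited_run: "visited k (run k S T t) = {position k S T s i | s i. s \<le> t \<and> i < k}"
  unfolding visited_def set_run by blast

lemma position_0 [simp]: "position k S T 0 i = root T"
  by (simp add: position_def)

lemma position_Suc:
  assumes "exploration_strategy k S" "i < k"
  shows "position k S T (Suc t) i = position k S T t i \<or>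
    (position k S T t i, position k S T (Suc t) i) \<in> edges T"
proof -
  let ?h = "run k S T t"
  have "?h \<noteq> []" by (cases t) (auto simp: Let_def)
  then have "S ?h (revealed T (visited k ?h)) i = hd ?h i \<or>
      (hd ?h i, S ?h (revealed T (visited k ?h)) i) \<in> revealed T (visited k ?h)"
    using assms unfolding exploration_strategy_def by blast
  then show ?thesis by (auto simp: position_def revealed_def Let_def)
qed

lemma position_in_verts:
  assumes "exploration_strategy k S" "i < k" "rooted_tree T"
  shows "position k S T t i \<in> verts T"
proof (induction t)
  case 0
  then show ?case using assms(3) by (simp add: rooted_tree_def)
next
  case (Suc t)
  then show ?case using position_Suc[OF assms(1,2), of T t] assms(3) by (auto simp: rooted_tree_def)
qed

lemma visited_subset_verts:
  assumes "exploration_strategy k S" "rooted_tree T"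
  shows "visited k (run k S T t) \<subseteq> verts T"
  using position_in_verts[OF assms(1) _ assms(2)] by (auto simp: visited_run)

text \<open>The strategy sees a tree only through the edges at visited vertices, so the adversary
  may change the rest retroactively. Subsets \<open>X\<close> occur because earlier rounds have
  smaller visited sets.\<close>

lemma run_cong:
  assumes "root T' = root T"
    and "\<And>X. X \<subseteq> visited k (run k S T t) \<Longrightarrow> revealed T' X = revealed T X"
    and "s \<le> t"
  shows "run k S T' s = run k S T s"
  using assms(3)
proof (induction s)
  case 0
  then show ?case using assms(1) by simp
next
  case (Suc s)
  have "visited k (run k S T s) \<subseteq> visited k (run k S T t)"
    using Suc.prems by (force simp: visited_run)
  with Suc assms(2) show ?case by (simp add: Let_def)
qed

text \<open>A branch is entered only through the root, and a round gains at most one level. The root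
  is treated separately because its own label may equal \<open>j\<close>.\<close>

lemma depth_in_entered_branch:
  assumes S: "exploration_strategy k S" "i < k"
    and T: "depth_labelling N par dep" "branch_labelling N par br"
    and start: "position k S (parent_graph N par) t i = 0 \<or>
      br (position k S (parent_graph N par) t i) \<noteq> j"
    and "br (position k S (parent_graph N par) (t + r) i) = j"
  shows "dep (position k S (parent_graph N par) (t + r) i) \<le> r"
proof -
  let ?p = "\<lambda>s. position k S (parent_graph N par) s i"
  have "?p (t + r) = 0 \<or> br (?p (t + r)) \<noteq> j \<or> dep (?p (t + r)) \<le> r"
  proof (induction r)
    case 0
    then show ?case using start depth_labellingD(2)[OF T(1)] by auto
  next
    case (Suc r)
    have "?p (t + Suc r) = ?p (t + r) \<or> (?p (t + r), ?p (t + Suc r)) \<in> edges (parent_graph N par)"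
      using position_Suc[OF S, of "parent_graph N par" "t + r"] by simp
    then consider "?p (t + Suc r) = ?p (t + r)"
      | "0 < ?p (t + Suc r)" "?p (t + Suc r) < N" "?p (t + r) = par (?p (t + Suc r))"
      | "0 < ?p (t + r)" "?p (t + r) < N" "?p (t + Suc r) = par (?p (t + r))"
      by auto
    then show ?case
    proof cases
      case 1
      then show ?thesis using Suc.IH by auto
    next
      case 2
      have "dep (?p (t + Suc r)) = Suc (dep (?p (t + r)))"
        using depth_labellingD(4)[OF T(1) 2(1,2)] 2(3) by simp
      moreover have "br (?p (t + Suc r)) = br (?p (t + r))" if "?p (t + r) \<noteq> 0"
        using T(2) 2 that unfolding branch_labelling_def by metis
      ultimately show ?thesis
        using Suc.IH depth_labellingD(2)[OF T(1)] by (cases "?p (t + r) = 0") auto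
    next
      case 3
      have "dep (?p (t + r)) = Suc (dep (?p (t + Suc r)))"
        using depth_labellingD(4)[OF T(1) 3(1,2)] 3(3) by simp
      moreover have "br (?p (t + r)) = br (?p (t + Suc r))" if "?p (t + Suc r) \<noteq> 0"
        using T(2) 3 that unfolding branch_labelling_def by metis
      ultimately show ?thesis using Suc.IH 3(1) by (cases "?p (t + Suc r) = 0") auto
    qed
  qed
  then show ?thesis using assms(6) depth_labellingD(2)[OF T(1)] by auto
qed

section \<open>The phases of the adversary\<close>

text \<open>Branch \<open>j\<close> has a leaf \<open>w\<close> at the maximal depth \<open>d\<close> to which the adversary can still attach
  children without contradicting what the team knows at time \<open>t\<close>.\<close>

definition alive :: "nat \<Rightarrow> nat strategy \<Rightarrow> nat \<Rightarrow> (nat \<Rightarrow> nat) \<Rightarrow> (nat \<Rightarrow> nat) \<Rightarrow> (nat \<Rightarrow> nat) \<Rightarrow>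
    nat \<Rightarrow> nat \<Rightarrow> nat \<Rightarrow> bool" where
  "alive k S N par dep br d t j \<longleftrightarrow>
     (\<exists>w<N. br w = j \<and> dep w = d \<and> (\<forall>v. 0 < v \<and> v < N \<longrightarrow> par v \<noteq> w) \<and>
        w \<notin> visited k (run k S (parent_graph N par) t))"

text \<open>The bound on all depths and one hidden leaf at depth \<open>d\<close> together fix the
  height at exactly \<open>d\<close>.\<close>

definition stage :: "nat \<Rightarrow> nat strategy \<Rightarrow> nat \<Rightarrow> (nat \<Rightarrow> nat) \<Rightarrow> (nat \<Rightarrow> nat) \<Rightarrow> (nat \<Rightarrow> nat) \<Rightarrow>
    nat \<Rightarrow> nat \<Rightarrow> nat set \<Rightarrow> bool" where
  "stage k S N par dep br d t A \<longleftrightarrow>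
     depth_labelling N par dep \<and> branch_labelling N par br \<and> (\<forall>v<N. dep v \<le> d) \<and>
     finite A \<and> (\<forall>j\<in>A. alive k S N par dep br d t j)"

lemma stage_step:
  assumes S: "exploration_strategy k S"
    and st: "stage k S N par dep br d t A"
    and A: "card A = q * M'" "2 \<le> q" "0 < M'"
    and d: "0 < d" "H \<le> d"
  defines "s \<equiv> Suc (H * (2 * k div card A))"
  obtains par' dep' br' A' where "stage k S (N + M' * s) par' dep' br' (Suc d) (t + H) A'" "card A' = M'"
proof -
  let ?T = "parent_graph N par"
  let ?p = "position k S ?T t"
  define b where "b = 2 * k div card A"
  have s: "s = Suc (H * b)" by (simp add: s_def b_def)
  have T: "depth_labelling N par dep" "branch_labelling N par br" and le: "\<And>v. v < N \<Longrightarrow> dep v \<le> d"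
    and fin: "finite A" and "\<forall>j\<in>A. alive k S N par dep br d t j"
    using st by (auto simp: stage_def)
  then have "\<forall>j\<in>A. \<exists>w. w < N \<and> br w = j \<and> dep w = d \<and> (\<forall>v. 0 < v \<and> v < N \<longrightarrow> par v \<noteq> w) \<and>
        w \<notin> visited k (run k S ?T t)"
    by (simp add: alive_def)
  then obtain w where w: "\<And>j. j \<in> A \<Longrightarrow> w j < N" "\<And>j. j \<in> A \<Longrightarrow> br (w j) = j"
    "\<And>j. j \<in> A \<Longrightarrow> dep (w j) = d" "\<And>j v. j \<in> A \<Longrightarrow> 0 < v \<Longrightarrow> v < N \<Longrightarrow> par v \<noteq> w j"
    "\<And>j. j \<in> A \<Longrightarrow> w j \<notin> visited k (run k S ?T t)"
    unfolding bchoice_iff by blast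
  have N0: "0 < N" using depth_labellingD(1)[OF T(1)] .

  define Ag where "Ag j = {a. a < k \<and> ?p a \<noteq> 0 \<and> br (?p a) = j}" for j
  have finAg: "finite (Ag j)" for j by (simp add: Ag_def)
  define B where "B = {j \<in> A. card (Ag j) \<le> b}"
  \<comment> \<open>Markov's inequality: fewer than half of the branches hold more than
    \<open>b\<close> agents, so with \<open>q \<ge> 2\<close> at least \<open>M'\<close> branches
    can be kept.\<close>
  have "card (A - B) * Suc b \<le> (\<Sum>j\<in>A - B. card (Ag j))"
    using sum_mono[of "A - B" "\<lambda>_. Suc b" "\<lambda>j. card (Ag j)"] by (force simp: B_def not_le Suc_le_eq)
  also have "\<dots> = card (\<Union>j\<in>A - B. Ag j)"
    using fin finAg by (subst card_UN_disjoint) (auto simp: Ag_def)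
  also have "\<dots> \<le> card {..<k}" by (intro card_mono) (auto simp: Ag_def)
  finally have "card (A - B) * Suc b \<le> k" by simp
  moreover have "2 * k < Suc b * card A"
    using dividend_less_times_div[of "card A" "2 * k"] A by (simp add: b_def mult.commute)
  ultimately have "(2 * card (A - B)) * Suc b < card A * Suc b" by (simp add: mult.commute)
  then have "2 * card (A - B) < card A" by (subst (asm) mult_less_cancel2) auto
  moreover have "card A = card B + card (A - B)"
    using fin card_mono[of A B] by (subst card_Diff_subset) (auto simp: B_def)
  moreover have "2 * M' \<le> card A" using A by simp
  ultimately have "M' \<le> card B" by linarith
  then obtain A' where A': "A' \<subseteq> B" "card A' = M'" "finite A'"
    by (rule obtain_subset_with_card_n)
  have A'A: "A' \<subseteq> A" using A' by (auto simp: B_def)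
  obtain e where e: "bij_betw e {0..<M'} A'" using ex_bij_betw_nat_finite[OF A'(3)] A'(2) by auto

  define N' where "N' = N + M' * s"
  \<comment> \<open>The new vertices form \<open>M'\<close> blocks of \<open>s\<close> consecutive
    numbers; block \<open>y\<close> hangs below the hidden leaf of branch
    \<open>e y\<close>.\<close>
  define ix where "ix v = e ((v - N) div s)" for v
  have ix: "ix v \<in> A'" if "v < N'" "\<not> v < N" for v
  proof -
    have "v - N < M' * s" using that by (simp add: N'_def)
    then have "(v - N) div s < M'" by (rule less_mult_imp_div_less)
    then show ?thesis unfolding ix_def using e by (auto simp: bij_betw_def)
  qed
  define par' where "par' v = (if v < N then par v else w (ix v))" for v
  define dep' where "dep' v = (if v < N then dep v else Suc d)" for v
  define br' where "br' v = (if v < N then br v else ix v)" for v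
  let ?T' = "parent_graph N' par'"
  have NN: "N \<le> N'" by (simp add: N'_def)
  have parN: "par' v < N" if "0 < v" "v < N'" for v
    using that ix[of v] A'A w(1) depth_labellingD(3)[OF T(1)] by (auto simp: par'_def)
  have T'1: "depth_labelling N' par' dep'"
    unfolding depth_labelling_def
  proof (intro conjI allI impI)
    show "0 < N'" "dep' 0 = 0" using N0 NN depth_labellingD(2)[OF T(1)] by (auto simp: dep'_def)
    fix v assume v: "0 < v \<and> v < N'"
    then show "par' v < N'" using parN[of v] NN by simp
    show "dep' v = Suc (dep' (par' v))"
      using v parN[of v] depth_labellingD(4)[OF T(1)] ix[of v] A'A w(3)
      by (auto simp: dep'_def par'_def)
  qed
  have T'2: "branch_labelling N' par' br'"
    unfolding branch_labelling_def
  proof (intro allI impI)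
    fix v assume v: "0 < v \<and> v < N' \<and> par' v \<noteq> 0"
    then show "br' v = br' (par' v)"
      using parN[of v] T(2) ix[of v] A'A w(2)
      by (auto simp: br'_def par'_def branch_labelling_def)
  qed
  have rt: "rooted_tree ?T" using T(1) by (rule rooted_tree_parent_graph)
  have vis: "visited k (run k S ?T t) \<subseteq> {..<N}" using visited_subset_verts[OF S rt] by simp
  \<comment> \<open>Every new edge joins a hidden leaf to a new vertex, both unvisited at time
    \<open>t\<close>, so the past run is the same in both trees.\<close>
  have "revealed ?T' X = revealed ?T X" if "X \<subseteq> visited k (run k S ?T t)" for X
  proof -
    have X: "x < N" if "x \<in> X" for x
      using that \<open>X \<subseteq> _\<close> vis by auto
    have wX: "w (ix v) \<notin> X" if "v < N'" "\<not> v < N" for v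
      using ix[OF that] \<open>X \<subseteq> _\<close> w(5) A'A by auto
    have child: "v < N' \<and> 0 < v \<and> u = par' v \<longleftrightarrow> v < N \<and> 0 < v \<and> u = par v"
      if "u \<in> X \<or> v \<in> X" for u v
    proof (cases "v < N")
      case True
      then show ?thesis using NN by (auto simp: par'_def)
    next
      case False
      then show ?thesis using that X[of v] wX[of v] by (auto simp: par'_def)
    qed
    have "(u, v) \<in> edges ?T' \<longleftrightarrow> (u, v) \<in> edges ?T" if "u \<in> X \<or> v \<in> X" for u v
    proof -
      have "(u, v) \<in> edges ?T' \<longleftrightarrow>
          (v < N' \<and> 0 < v \<and> u = par' v) \<or> (u < N' \<and> 0 < u \<and> v = par' u)"
        using depth_labellingD(3)[OF T'1] by auto
      also have "\<dots> \<longleftrightarrow> (v < N \<and> 0 < v \<and> u = par v) \<or> (u < N \<and> 0 < u \<and> v = par u)"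
        using child[of u v] child[of v u] that by blast
      also have "\<dots> \<longleftrightarrow> (u, v) \<in> edges ?T"
        using depth_labellingD(3)[OF T(1)] by auto
      finally show ?thesis .
    qed
    then show ?thesis
      unfolding revealed_def by (intro Collect_cong) (simp only: split_paired_all prod.case, blast)
  qed
  then have run: "run k S ?T' r = run k S ?T r" if "r \<le> t" for r
    using that by (intro run_cong[where t = t]) simp_all
  then have pos: "position k S ?T' r = position k S ?T r" if "r \<le> t" for r
    using that by (simp add: position_def)
  have posN: "position k S ?T t a < N" if "a < k" for a
    using position_in_verts[OF S that rt] by simp

  have "alive k S N' par' dep' br' (Suc d) (t + H) j" if j: "j \<in> A'" for j
  proof -
    obtain y where y: "y < M'" "e y = j" using e j by (auto simp: bij_betw_def)
    define Ch where "Ch = {N + y * s..<N + Suc y * s}"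
    have "Suc y * s \<le> M' * s" using y by (intro mult_right_mono) auto
    then have Ch: "N \<le> v" "v < N'" "ix v = j" if "v \<in> Ch" for v
    proof -
      have v: "N + y * s \<le> v" "v < N + Suc y * s" using that by (auto simp: Ch_def)
      then show "N \<le> v" "v < N'" using \<open>Suc y * s \<le> M' * s\<close> by (auto simp: N'_def)
      have "(v - N) div s = y" using v by (intro div_nat_eqI) (auto simp: mult.commute)
      then show "ix v = j" using y by (simp add: ix_def)
    qed
    \<comment> \<open>The vertices occupied during the phase by the at most \<open>b\<close> agents
      that start inside the branch: at most \<open>H * b\<close>, one fewer than the new
      children.\<close>
    let ?P = "(\<lambda>(r, a). position k S ?T' r a) ` ({t<..t + H} \<times> Ag j)"
    have "card ?P \<le> H * card (Ag j)"
      using card_image_le[of "{t<..t + H} \<times> Ag j"] finAg by fastforce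
    also have "\<dots> \<le> H * b" using j A' by (intro mult_left_mono) (auto simp: B_def)
    also have "\<dots> < card Ch" by (simp add: Ch_def s)
    finally have "\<not> Ch \<subseteq> ?P" using card_mono[of ?P Ch] finAg by fastforce
    then obtain v where v: "v \<in> Ch" "v \<notin> ?P" by blast
    have "v \<notin> visited k (run k S ?T' (t + H))"
    proof
      assume "v \<in> visited k (run k S ?T' (t + H))"
      then obtain r a where r: "r \<le> t + H" "a < k" "v = position k S ?T' r a"
        unfolding visited_run by blast
      \<comment> \<open>A visit to \<open>v\<close> must happen after time \<open>t\<close> and by
        an agent from outside the branch, which would need \<open>Suc d > H\<close> rounds.\<close>
      have "t < r"
      proof (rule ccontr)
        assume "\<not> t < r"
        then have "v < N" using r pos position_in_verts[OF S r(2) rt, of r] by simp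
        then show False using Ch[OF v(1)] by simp
      qed
      then have "a \<notin> Ag j" using v(2) r by force
      then have "position k S ?T' t a = 0 \<or> br' (position k S ?T' t a) \<noteq> j"
        using r(2) pos[of t] posN[of a] by (auto simp: Ag_def br'_def)
      moreover have "br' (position k S ?T' (t + (r - t)) a) = j"
        using r(3) \<open>t < r\<close> Ch[OF v(1)] by (simp add: br'_def)
      ultimately have "dep' (position k S ?T' (t + (r - t)) a) \<le> r - t"
        by (intro depth_in_entered_branch[OF S r(2) T'1 T'2])
      then have "dep' v \<le> r - t" using r(3) \<open>t < r\<close> by simp
      moreover have "dep' v = Suc d" using Ch[OF v(1)] by (simp add: dep'_def)
      ultimately show False using r(1) d by simp
    qed
    moreover have "\<forall>u. 0 < u \<and> u < N' \<longrightarrow> par' u \<noteq> v" using parN Ch(1)[OF v(1)] by (metis not_le)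
    ultimately show ?thesis
      unfolding alive_def using Ch[OF v(1)] by (intro exI[of _ v]) (auto simp: br'_def dep'_def)
  qed
  moreover have "dep' v \<le> Suc d" if "v < N'" for v using le[of v] by (auto simp: dep'_def)
  ultimately have "stage k S N' par' dep' br' (Suc d) (t + H) A'"
    using T'1 T'2 A'(3) by (simp add: stage_def)
  with A'(2) show ?thesis using that by (simp add: N'_def)
qed

text \<open>No agent reaches depth \<open>H\<close> before round \<open>H\<close>. The general
  \<open>t\<close> also serves bounded \<open>k\<close>, where one path is used up to time
  \<open>H - 1\<close>.\<close>

lemma initial_stage:
  assumes S: "exploration_strategy k S" and "0 < H" "t < H"
  obtains par dep br where "stage k S (Suc (m * H) + x) par dep br H t {..<m}"
proof -
  \<comment> \<open>Vertices \<open>j H + 1, \<dots>, (j + 1) H\<close> form the \<open>j\<close>-th path, from the root downwards.\<close>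
  define N where "N = Suc (m * H) + x"
  define par where "par v = (if v \<le> m * H \<and> (v - 1) mod H \<noteq> 0 then v - 1 else 0)" for v :: nat
  define dep where "dep v = (if v = 0 then 0 else if v \<le> m * H then Suc ((v - 1) mod H) else 1)" for v :: nat
  define br where "br v = (v - 1) div H" for v :: nat
  have mod: "\<exists>u. v = Suc (Suc u) \<and> u mod H = v' \<and> u div H = (v - 1) div H"
    if eq: "(v - 1) mod H = Suc v'" for v v'
  proof -
    obtain u where u: "v = Suc (Suc u)" using eq by (cases v; cases "v - 1") auto
    then show ?thesis using eq by (auto simp: mod_Suc div_Suc split: if_splits)
  qed
  have T1: "depth_labelling N par dep"
    unfolding depth_labelling_def
  proof (intro conjI allI impI)
    show "0 < N" "dep 0 = 0" by (auto simp: N_def dep_def)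
    fix v assume v: "0 < v \<and> v < N"
    then show "par v < N" by (auto simp: par_def)
    show "dep v = Suc (dep (par v))"
    proof (cases "v \<le> m * H \<and> (v - 1) mod H \<noteq> 0")
      case True
      then obtain v' where "(v - 1) mod H = Suc v'" by (metis not0_implies_Suc)
      with mod[OF this] True show ?thesis by (auto simp: dep_def par_def)
    qed (use v in \<open>auto simp: dep_def par_def\<close>)
  qed
  have T2: "branch_labelling N par br"
    unfolding branch_labelling_def
  proof (intro allI impI)
    fix v assume "0 < v \<and> v < N \<and> par v \<noteq> 0"
    then have "(v - 1) mod H \<noteq> 0" and p: "par v = v - 1" by (auto simp: par_def split: if_splits)
    then obtain v' where "(v - 1) mod H = Suc v'" by (metis not0_implies_Suc)
    from mod[OF this] p show "br v = br (par v)" by (auto simp: br_def)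
  qed
  have "alive k S N par dep br H t j" if j: "j < m" for j
  proof -
    define w where "w = Suc j * H"
    have w: "w \<le> m * H" using j unfolding w_def by (intro mult_right_mono) auto
    have w1: "w - 1 = j * H + (H - 1)" using assms by (simp add: w_def)
    have wm: "(w - 1) mod H = H - 1" "(w - 1) div H = j"
      unfolding w1 using assms(2) by (simp_all only: mod_mult_self3 div_mult_self3) auto
    have "w \<noteq> 0" using assms by (simp add: w_def)
    then have dw: "dep w = H" using assms w wm by (simp add: dep_def)
    have "par v \<noteq> w" if "0 < v" "v < N" for v
    proof
      assume "par v = w"
      then have "v = Suc w" "w mod H \<noteq> 0" using \<open>w \<noteq> 0\<close> that by (auto simp: par_def split: if_splits)
      then show False by (simp add: w_def)
    qed
    moreover have "w \<notin> visited k (run k S (parent_graph N par) t)"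
    proof
      assume "w \<in> visited k (run k S (parent_graph N par) t)"
      \<comment> \<open>The form \<open>0 + r\<close> lets \<open>depth_in_entered_branch\<close>
        count from the start at the root.\<close>
      then obtain r a where r: "r \<le> t" "a < k" "w = position k S (parent_graph N par) (0 + r) a"
        unfolding visited_run by auto
      have "dep w \<le> r"
        unfolding r(3) by (rule depth_in_entered_branch[OF S r(2) T1 T2]) auto
      then show False using dw r(1) assms(3) by simp
    qed
    ultimately show ?thesis unfolding alive_def
      using w dw wm by (intro exI[of _ w]) (auto simp: N_def br_def)
  qed
  moreover have "dep v \<le> H" for v using assms by (auto simp: dep_def Suc_le_eq)
  ultimately show ?thesis using T1 T2 that unfolding N_def[symmetric] stage_def by blast
qed

lemma stage_imp_tree:
  assumes "stage k S N par dep br d t A" "A \<noteq> {}"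
  shows "rooted_tree (parent_graph N par)" "height (parent_graph N par) = d"
    "\<not> explored_after k S (parent_graph N par) t"
proof -
  from assms obtain w where w: "w < N" "dep w = d" "w \<notin> visited k (run k S (parent_graph N par) t)"
    by (force simp: stage_def alive_def)
  show "rooted_tree (parent_graph N par)" "height (parent_graph N par) = d"
    using assms w rooted_tree_parent_graph height_parent_graph by (auto simp: stage_def)
  show "\<not> explored_after k S (parent_graph N par) t"
    using w by (auto simp: explored_after_def)
qed

lemma explored_after_mono:
  assumes "explored_after k S T s" "s \<le> t"
  shows "explored_after k S T t"
  using assms by (fastforce simp: explored_after_def visited_run)

text \<open>Phase \<open>l\<close> starts with \<open>q ^ (P - l)\<close> live branches and keeps
  \<open>q ^ (P - Suc l)\<close>; the summand counts the vertices attached to these.\<close>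

lemma iterated_stages:
  assumes S: "exploration_strategy k S" and q: "2 \<le> q" and H: "0 < H"
    and x: "stage k S N par dep br H 0 A" "card A = q ^ P" and "i \<le> P"
  shows "\<exists>par dep br A. stage k S (N + (\<Sum>l<i. q ^ (P - Suc l) * Suc (H * (2 * k div q ^ (P - l)))))
    par dep br (H + i) (i * H) A \<and> card A = q ^ (P - i)"
  using assms(6)
proof (induction i)
  case 0
  then show ?case using x by auto
next
  case (Suc i)
  then obtain par dep br A where st: "stage k S (N + (\<Sum>l<i. q ^ (P - Suc l) * Suc (H * (2 * k div q ^ (P - l)))))
    par dep br (H + i) (i * H) A" and c: "card A = q ^ (P - i)"
    by auto
  have "P - i = Suc (P - Suc i)" using Suc.prems by simp
  then have cA: "card A = q * q ^ (P - Suc i)" using c by simp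
  obtain par' dep' br' A' where "stage k S (N + (\<Sum>l<i. q ^ (P - Suc l) * Suc (H * (2 * k div q ^ (P - l)))) +
      q ^ (P - Suc i) * Suc (H * (2 * k div card A)))
    par' dep' br' (Suc (H + i)) (i * H + H) A'" "card A' = q ^ (P - Suc i)"
    by (rule stage_step[OF S st cA q, of H]) (use q H in auto)
  then show ?case
    unfolding c sum.lessThan_Suc add.assoc[symmetric] add_Suc_right mult_Suc add.commute[of H "i * H"]
    by blast
qed

text \<open>The hypothesis bounds the vertex count multiplied by \<open>q\<close>, which avoids the
  quotient \<open>2 k / q\<close>. The 2 in \<open>2 * q ^ P * H\<close> pays for the initial paths
  and for the \<open>Suc\<close> in each summand, at most \<open>q ^ P\<close> vertices in each of
  \<open>P \<le> H\<close> phases.\<close>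

lemma tree_with_hidden_vertex:
  assumes S: "exploration_strategy k S" and q: "2 \<le> q" and H: "0 < H" and P: "P \<le> H"
    and n: "q * (Suc (2 * q ^ P * H)) + 2 * k * H * P \<le> q * n"
  shows "\<exists>T :: nat rooted_graph. rooted_tree T \<and> card (verts T) = n \<and> height T = H + P \<and>
    \<not> explored_after k S T (P * H)"
proof -
  let ?s = "\<lambda>l. q ^ (P - Suc l) * Suc (H * (2 * k div q ^ (P - l)))"
  have "q * ?s l \<le> q * q ^ P + 2 * k * H" if "l < P" for l
  proof -
    have "P - l = Suc (P - Suc l)" using that by simp
    then have "q * ?s l = q ^ (P - l) + H * (q ^ (P - l) * (2 * k div q ^ (P - l)))"
      by (simp add: algebra_simps)
    also have "\<dots> \<le> q ^ P + H * (2 * k)"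
      using q by (intro add_mono mult_left_mono power_increasing times_div_less_eq_dividend) auto
    also have "\<dots> \<le> q * q ^ P + 2 * k * H" using q by simp
    finally show ?thesis .
  qed
  then have "(\<Sum>l<P. q * ?s l) \<le> (\<Sum>l<P. q * q ^ P + 2 * k * H)" by (intro sum_mono) auto
  then have "q * (\<Sum>l<P. ?s l) \<le> P * (q * q ^ P) + 2 * k * H * P"
    by (simp add: sum_distrib_left algebra_simps)
  moreover have "P * (q * q ^ P) \<le> H * (q * q ^ P)" using P by (rule mult_right_mono) simp
  moreover have "q * (Suc (q ^ P * H) + (\<Sum>l<P. ?s l)) =
      q + H * (q * q ^ P) + q * (\<Sum>l<P. ?s l)"
    by (simp only: mult_Suc_right distrib_left mult_ac add_ac)
  moreover have "q + 2 * (H * (q * q ^ P)) + 2 * k * H * P \<le> q * n"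
    using n by (simp add: mult_ac)
  ultimately have "q * (Suc (q ^ P * H) + (\<Sum>l<P. ?s l)) \<le> q * n"
    by linarith
  then have "Suc (q ^ P * H) + (\<Sum>l<P. ?s l) \<le> n" using q by (subst (asm) mult_le_cancel1) auto
  \<comment> \<open>The slack \<open>y\<close> becomes extra leaves at the root, which makes the
    number of vertices exactly \<open>n\<close>.\<close>
  then obtain y where "n = Suc (q ^ P * H) + (\<Sum>l<P. ?s l) + y" by (rule less_eqE)
  then have "n = Suc (q ^ P * H) + y + (\<Sum>l<P. ?s l)" by (simp only: ac_simps)
  then obtain x where x: "n = Suc (q ^ P * H) + x + (\<Sum>l<P. ?s l)" by (rule that)
  obtain par dep br where "stage k S (Suc (q ^ P * H) + x) par dep br H 0 {..<q ^ P}"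
    using initial_stage[OF S H H] .
  from iterated_stages[OF S q H this, of P P] obtain par dep br A
    where "stage k S n par dep br (H + P) (P * H) A" "card A = 1"
    by (auto simp: x)
  then show ?thesis using stage_imp_tree[of k S n par dep br "H + P" "P * H" A]
    by (intro exI[of _ "parent_graph n par"]) force
qed


section \<open>Choice of the parameters\<close>

lemma eventually_log_bounds:
  "eventually (\<lambda>k :: nat. 2 ^ (c + 4) \<le> nat \<lceil>ln (real k)\<rceil> \<and>
     (nat \<lceil>ln (real k)\<rceil> ^ (c + 3)) ^ 2 \<le> k \<and> 0 < ln (ln (real k)) \<and>
     ln (nat \<lceil>ln (real k)\<rceil>) \<le> 2 * ln (ln (real k))) at_top"
proof -
  \<comment> \<open>The ceiling lies between \<open>ln k\<close> and \<open>ln k + 1\<close>; each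
    growth fact is stated for the end that it needs, free of rounding.\<close>
  have 1: "eventually (\<lambda>k :: nat. 2 ^ (c + 4) \<le> ln (real k)) at_top"
    by real_asymp
  have 2: "eventually (\<lambda>k :: nat. (ln (real k) + 1) ^ (2 * (c + 3)) \<le> real k) at_top"
    by real_asymp
  have 3: "eventually (\<lambda>k :: nat. 0 < ln (ln (real k))) at_top"
    by real_asymp
  have 4: "eventually (\<lambda>k :: nat. ln (ln (real k) + 1) \<le> 2 * ln (ln (real k))) at_top"
    by real_asymp
  show ?thesis
    using 1 2 3 4
  proof eventually_elim
    case (elim k)
    let ?l = "nat \<lceil>ln (real k)\<rceil>"
    have "(0::real) < 2 ^ (c + 4)" by simp
    then have pos: "0 < ln (real k)" using elim(1) by linarith
    have l: "ln (real k) \<le> ?l" "?l \<le> ln (real k) + 1" using pos by linarith+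
    have "real (2 ^ (c + 4)) \<le> real ?l"
      by (rule order_trans[OF _ l(1)]) (use elim(1) in simp)
    then have "2 ^ (c + 4) \<le> ?l" by (simp only: of_nat_le_iff)
    moreover have "real ((?l ^ (c + 3)) ^ 2) \<le> real k"
    proof -
      have "real ((?l ^ (c + 3)) ^ 2) = real ?l ^ (2 * (c + 3))"
        by (simp only: of_nat_power power_mult[symmetric] mult.commute)
      also have "\<dots> \<le> (ln (real k) + 1) ^ (2 * (c + 3))" using l by (intro power_mono) auto
      also note elim(2)
      finally show ?thesis .
    qed
    then have "(?l ^ (c + 3)) ^ 2 \<le> k" by (simp only: of_nat_le_iff)
    moreover have "ln ?l \<le> ln (ln (real k) + 1)" using l pos by (subst ln_le_cancel_iff) auto
    ultimately show ?case using elim by auto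
  qed
qed

text \<open>\<open>P\<close> is at least of order \<open>ln k / ln (ln k)\<close> and
  \<open>n/k + H + P\<close> at most of order \<open>H\<close>, so \<open>P * H\<close> rounds match
  the claimed bound.\<close>

lemma parameter_choice:
  fixes k n c :: nat
  defines "l \<equiv> nat \<lceil>ln (real k)\<rceil>"
  assumes k: "1 \<le> k" "real k \<le> real n * ln (real n) ^ c"
    and l: "2 ^ (c + 4) \<le> l" and q2: "(l ^ (c + 3)) ^ 2 \<le> k" and lnln: "0 < ln (ln (real k))"
    and lnl: "ln l \<le> 2 * ln (ln (real k))"
  obtains q P H where "2 \<le> q" "0 < H" "P \<le> H"
    "q * Suc (2 * q ^ P * H) + 2 * k * H * P \<le> q * n"
    "ln (real k) / ln (ln (real k)) * (real n / real k + real (H + P)) \<le> 18 * real (c + 3) * real (P * H)"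
proof -
  \<comment> \<open>In the exponent, \<open>c + 1\<close> covers \<open>k H / n\<close>, one more
    the factor \<open>P\<close>, and one more the constant \<open>2 ^ (c + 4)\<close>.\<close>
  define q where "q = l ^ (c + 3)"
  have "2 ^ 4 \<le> (2::nat) ^ (c + 4)" by (rule power_increasing) auto
  then have l16: "16 \<le> l" using l by simp
  have ql: "l \<le> q" unfolding q_def using l16 self_le_power[of l "c + 3"] by auto
  have ge2: "2 \<le> q" using ql l16 by simp
  \<comment> \<open>Take \<open>P\<close> maximal with \<open>q ^ (P + 1) \<le> k\<close>; the spare factor \<open>q\<close> pays for the polylogarithmic
    factors in \<open>6 q\<^sup>P H \<le> n\<close>.\<close>
  obtain p where p: "q ^ p \<le> k" "k < q ^ (p + 1)" using ex_power_ivl1[OF ge2 k(1)] by blast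
  \<comment> \<open>This gives \<open>p \<ge> 2\<close>, hence \<open>P \<ge> 1\<close> and later
    \<open>P + 2 \<le> 3 P\<close>.\<close>
  have "q ^ 2 < q ^ (p + 1)" using q2 p(2) by (simp add: q_def)
  then have "2 < p + 1" using ge2 by (subst (asm) power_strict_increasing_iff) auto
  then obtain P where P: "p = Suc P" "1 \<le> P" by (cases p) auto
  define m where "m = q ^ P"
  have m: "m * q \<le> k" "1 \<le> m" using p(1) P ge2 by (auto simp: m_def mult.commute)
  \<comment> \<open>\<open>n div k + 1\<close> exceeds \<open>n/k\<close>, and \<open>l\<close>
    ensures \<open>P \<le> H\<close>.\<close>
  define H where "H = n div k + Suc l"
  have lnk: "0 \<le> ln (real k)" "ln (real k) \<le> l" using k(1) unfolding l_def by (auto simp: of_nat_ceiling)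

  \<comment> \<open>\<open>exp 1 \<le> q\<close> turns \<open>q ^ p \<le> k\<close> into
    \<open>p \<le> ln k\<close>.\<close>
  have "real P \<le> real l"
  proof -
    have "exp 1 \<le> real q" using exp_le ql l16 by (intro order_trans[OF exp_le]) simp
    then have "exp 1 ^ p \<le> real q ^ p" by (intro power_mono) auto
    also have "\<dots> \<le> real k" using p(1) by (metis of_nat_le_iff of_nat_power)
    finally have "exp (real p) \<le> real k" by (simp add: exp_of_nat_mult[symmetric])
    then have "real p \<le> ln (real k)" using k(1) by (subst ln_ge_iff) auto
    then show ?thesis using lnk P by simp
  qed
  then have Pl: "P \<le> l" by simp

  have n0: "n \<noteq> 0" using k by (cases "n = 0") auto
  \<comment> \<open>This trades \<open>ln n\<close> for \<open>ln k\<close>: if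
    \<open>n \<le> k ^ 2\<close> then \<open>ln n \<le> 2 l\<close>, and otherwise
    \<open>k \<le> n\<close> already.\<close>
  have kn: "k \<le> n * (2 * l) ^ c"
  proof (cases "n \<le> k ^ 2")
    case True
    have "real n \<le> real k ^ 2" using True by (metis of_nat_le_iff of_nat_power)
    then have "ln (real n) \<le> ln (real k ^ 2)" using n0 k(1) by (subst ln_le_cancel_iff) auto
    also have "\<dots> \<le> 2 * real l" using lnk k(1) by (simp add: ln_realpow)
    finally have "real n * ln (real n) ^ c \<le> real n * (2 * real l) ^ c"
      using n0 by (intro mult_left_mono power_mono) auto
    with k(2) have "real k \<le> real (n * (2 * l) ^ c)" by simp
    then show ?thesis by (simp only: of_nat_le_iff)
  next
    case False
    then have "k \<le> n" using self_le_power[of k 2] k(1) by simp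
    also have "\<dots> \<le> n * (2 * l) ^ c" using l16 by simp
    finally show ?thesis .
  qed

  \<comment> \<open>First half of the budget: \<open>2 k H P\<close> is at most
    \<open>q n / 2\<close>.\<close>
  have kH: "k * H \<le> n + k * Suc l"
    by (simp add: H_def distrib_left)
  have aux: "Suc l * (2 * l) ^ c \<le> 2 ^ (c + 1) * l ^ (c + 1)"
  proof -
    have "Suc l * (2 * l) ^ c \<le> (2 * l) * (2 * l) ^ c" using l16 by (intro mult_right_mono) auto
    then show ?thesis by (simp add: power_mult_distrib mult_ac)
  qed
  have "k * Suc l \<le> n * (2 * l) ^ c * Suc l" using kn by (rule mult_right_mono) simp
  also have "\<dots> \<le> n * (2 ^ (c + 1) * l ^ (c + 1))"
    unfolding mult.assoc using aux by (intro mult_left_mono) (auto simp: mult.commute)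
  finally have kl: "k * Suc l \<le> n * (2 ^ (c + 1) * l ^ (c + 1))" .
  have "n * 1 \<le> n * (2 ^ (c + 1) * l ^ (c + 1))" using l16 by (intro mult_left_mono) auto
  with kl kH have "k * H \<le> 2 * (n * (2 ^ (c + 1) * l ^ (c + 1)))" by linarith
  then have "k * H \<le> n * (2 ^ (c + 2) * l ^ (c + 1))" by (simp add: mult_ac)
  then have "(k * H) * P \<le> n * (2 ^ (c + 2) * l ^ (c + 1)) * l"
    using Pl by (rule mult_mono) auto
  then have "4 * (k * H * P) \<le> n * (2 ^ (c + 4) * l ^ (c + 2))" by (simp add: mult_ac power_add)
  also have "\<dots> \<le> n * (l * l ^ (c + 2))" using l by (intro mult_left_mono mult_right_mono) auto
  finally have A: "4 * (k * H * P) \<le> q * n" by (simp add: q_def mult_ac power_add eval_nat_numeral)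

  \<comment> \<open>Second half: \<open>q * Suc (2 m H)\<close> is at most \<open>q n / 2\<close>.
    The two summands of \<open>H\<close> are bounded separately in \<open>B1\<close> and
    \<open>B2\<close>, which add up to \<open>6 m H \<le> n\<close>.\<close>
  have "Suc l * (2 * l) ^ c * 12 \<le> 2 ^ (c + 1) * l ^ (c + 1) * l"
    by (rule mult_mono[OF aux]) (use l16 in auto)
  also have "\<dots> \<le> l * l ^ (c + 1) * l"
    using l by (intro mult_right_mono) (auto simp: power_add)
  also have "\<dots> = q" by (simp add: q_def power_add eval_nat_numeral)
  finally have "m * (Suc l * (2 * l) ^ c * 12) \<le> m * q"
    by (rule mult_left_mono) simp
  also have "\<dots> \<le> n * (2 * l) ^ c" using m(1) kn by linarith
  finally have "(12 * m * Suc l) * (2 * l) ^ c \<le> n * (2 * l) ^ c" by (simp only: mult_ac)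
  then have B1: "12 * m * Suc l \<le> n" using l16 by (subst (asm) mult_le_cancel2) auto
  have "12 * m \<le> m * q" using ql l16 by simp
  then have "12 * m \<le> k" using m(1) by linarith
  then have "12 * m * (n div k) \<le> k * (n div k)" by (rule mult_right_mono) simp
  also have "\<dots> \<le> n" by simp
  finally have B2: "12 * m * (n div k) \<le> n" .
  have "1 \<le> m * H" using m(2) by (simp add: H_def)
  then have "2 * Suc (2 * m * H) \<le> 6 * m * H" by simp
  also have "\<dots> \<le> n" using B1 B2 by (simp add: H_def distrib_left)
  finally have "q * (2 * Suc (2 * m * H)) \<le> q * n" by (rule mult_left_mono) simp
  with A have "q * Suc (2 * m * H) + 2 * k * H * P \<le> q * n" by (simp add: algebra_simps)
  moreover have "ln (real k) / ln (ln (real k)) * (real n / real k + real (H + P)) \<le>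
    (6 * real (c + 3) * real P) * (3 * real H)"
  proof (rule mult_mono)
    \<comment> \<open>Maximality of \<open>p\<close> gives \<open>k < q ^ (P + 2)\<close>, so
      \<open>P\<close> is at least of order \<open>ln k / ln q\<close>, and \<open>ln q\<close> is
      of order \<open>ln (ln k)\<close>.\<close>
    have "ln (real q) = real (c + 3) * ln l"
      unfolding q_def of_nat_power by (rule ln_realpow)
    moreover have "ln (real q ^ (p + 1)) = real (p + 1) * ln (real q)"
      by (rule ln_realpow)
    ultimately have lnq: "ln (real q ^ (p + 1)) = (real P + 2) * (real (c + 3) * ln l)"
      using P by simp
    have "real k < real q ^ (p + 1)" using p(2) by (metis of_nat_less_iff of_nat_power)
    then have "ln (real k) < ln (real q ^ (p + 1))" using k(1) ge2 by (subst ln_less_cancel_iff) auto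
    also have "\<dots> = (real P + 2) * (real (c + 3) * ln l)" by (rule lnq)
    also have "\<dots> \<le> (3 * real P) * (real (c + 3) * (2 * ln (ln (real k))))"
      using P lnl l16 by (intro mult_mono) auto
    finally show "ln (real k) / ln (ln (real k)) \<le> 6 * real (c + 3) * real P"
      using lnln by (simp add: field_simps)
    have "n < k * Suc (n div k)" using k(1) dividend_less_times_div[of k n] by simp
    also have "\<dots> \<le> k * H" unfolding H_def by (intro mult_left_mono) auto
    finally have "real n \<le> real k * real H" by (metis less_imp_le of_nat_le_iff of_nat_mult)
    then have "real n / real k \<le> real H" using k(1) by (simp add: field_simps)
    then show "real n / real k + real (H + P) \<le> 3 * real H" using Pl by (simp add: H_def)
  qed auto
  moreover have "(6 * real (c + 3) * real P) * (3 * real H) = 18 * real (c + 3) * real (P * H)"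
    by simp
  moreover have "0 < H" "P \<le> H" using Pl by (simp_all add: H_def)
  ultimately show ?thesis using that[OF ge2, of H P] unfolding m_def by linarith
qed

section \<open>Constants for large and for bounded \<open>k\<close>\<close>

theorem theorem1:
  fixes c :: nat
  assumes "c \<ge> 1"
  shows "\<exists>C::real. C > 0 \<and>
    (\<forall>n k :: nat. 1 \<le> k \<and> real k \<le> real n * ln (real n) ^ c \<longrightarrow>
      (\<exists>D::nat. \<forall>S :: nat strategy. exploration_strategy k S \<longrightarrow>
        (\<exists>T :: nat rooted_graph. rooted_tree T \<and> card (verts T) = n \<and> height T = D \<and>
          needs_at_least_rounds k S T
            (C * (ln (real k) / ln (ln (real k))) * (real n / real k + real D)))))"
proof -
  let ?r = "\<lambda>k::nat. ln (real k) / ln (ln (real k))"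
  obtain k0 where k0: "\<And>k. k0 \<le> k \<Longrightarrow> 2 ^ (c + 4) \<le> nat \<lceil>ln (real k)\<rceil> \<and>
     (nat \<lceil>ln (real k)\<rceil> ^ (c + 3)) ^ 2 \<le> k \<and> 0 < ln (ln (real k)) \<and>
     ln (nat \<lceil>ln (real k)\<rceil>) \<le> 2 * ln (ln (real k))"
    using eventually_log_bounds[of c] unfolding eventually_sequentially by blast
  \<comment> \<open>Absolute values, because the ratio is negative at \<open>k = 2\<close>; at
    \<open>k = 1\<close> it is \<open>0 / 0 = 0\<close>.\<close>
  define R where "R = 1 + (\<Sum>k<k0. \<bar>?r k\<bar>)"
  have R: "?r k \<le> R" if "k < k0" for k
  proof -
    have "\<bar>?r k\<bar> \<le> (\<Sum>k<k0. \<bar>?r k\<bar>)" using that by (intro member_le_sum) auto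
    then show ?thesis unfolding R_def by linarith
  qed
  have R1: "1 \<le> R" by (simp add: R_def sum_nonneg)
  \<comment> \<open>The first term serves large \<open>k\<close>; the second makes \<open>C\<close>
    times the ratio at most \<open>1/3\<close> for \<open>k < k0\<close>.\<close>
  define C where "C = min (1 / (18 * real (c + 3))) (1 / (3 * R))"
  have C: "0 < C" "C * (18 * real (c + 3)) \<le> 1" "C * R \<le> 1 / 3"
  proof -
    show "0 < C" using R1 by (simp add: C_def)
    have "C \<le> 1 / (18 * real (c + 3))" "C \<le> 1 / (3 * R)" by (simp_all add: C_def)
    then show "C * (18 * real (c + 3)) \<le> 1" "C * R \<le> 1 / 3"
      using R1 by (simp_all add: pos_le_divide_eq mult_ac)
  qed
  show ?thesis
  proof (intro exI[of _ C] conjI allI impI C(1))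
    fix n k :: nat
    assume "1 \<le> k \<and> real k \<le> real n * ln (real n) ^ c"
    then have k: "1 \<le> k" "real k \<le> real n * ln (real n) ^ c" by auto
    show "\<exists>D::nat. \<forall>S :: nat strategy. exploration_strategy k S \<longrightarrow>
        (\<exists>T :: nat rooted_graph. rooted_tree T \<and> card (verts T) = n \<and> height T = D \<and>
          needs_at_least_rounds k S T (C * ?r k * (real n / real k + real D)))"
    proof (cases "k < k0")
      case False
      then have "k0 \<le> k" by simp
      then obtain q P H where par: "2 \<le> q" "0 < H" "P \<le> H"
          "q * Suc (2 * q ^ P * H) + 2 * k * H * P \<le> q * n"
        and le: "?r k * (real n / real k + real (H + P)) \<le> 18 * real (c + 3) * real (P * H)"
        using parameter_choice[OF k, of thesis] k0[of k] by blast
      have "C * (?r k * (real n / real k + real (H + P))) \<le> C * (18 * real (c + 3) * real (P * H))"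
        using le C(1) by (intro mult_left_mono) auto
      also have "\<dots> = C * (18 * real (c + 3)) * real (P * H)" by (simp only: mult.assoc)
      also have "\<dots> \<le> 1 * real (P * H)" using C(2) by (intro mult_right_mono) auto
      finally have bound: "C * ?r k * (real n / real k + real (H + P)) \<le> real (P * H)"
        by (simp add: mult.assoc)
      show ?thesis
      \<comment> \<open>\<open>H + P\<close> is fixed before the strategy, as the order of
        quantifiers demands.\<close>
      proof (intro exI[of _ "H + P"] allI impI)
        fix S :: "nat strategy"
        assume "exploration_strategy k S"
        from tree_with_hidden_vertex[OF this par] obtain T :: "nat rooted_graph"
          where T: "rooted_tree T" "card (verts T) = n" "height T = H + P"
            "\<not> explored_after k S T (P * H)" by blast
        have "\<not> explored_after k S T s"
          if "real s < C * ?r k * (real n / real k + real (H + P))" for s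
          using that bound T(4) explored_after_mono[of k S T s "P * H"] by linarith
        with T show "\<exists>T :: nat rooted_graph. rooted_tree T \<and> card (verts T) = n \<and> height T = H + P \<and>
          needs_at_least_rounds k S T (C * ?r k * (real n / real k + real (H + P)))"
          unfolding needs_at_least_rounds_def by blast
      qed
    next
      \<comment> \<open>A path with \<open>D = n - 1\<close> suffices: \<open>C\<close> times the
        ratio is at most \<open>1/3\<close>, and
        \<open>n/k + D \<le> n + D \<le> 3 D\<close>.\<close>
      case True
      have "n \<noteq> 0" using k by (cases "n = 0") auto
      \<comment> \<open>For \<open>n = 1\<close> the upper bound on \<open>k\<close> is 0, because
        \<open>ln 1 = 0\<close> and \<open>c \<ge> 1\<close>.\<close>
      moreover have "n \<noteq> 1" using k assms by (cases "n = 1") (auto simp: power_0_left)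
      ultimately obtain d where n: "n = Suc (Suc d)" by (metis One_nat_def not0_implies_Suc)
      have "C * ?r k \<le> C * R" using R[OF True] C(1) by (intro mult_left_mono) auto
      then have "C * ?r k \<le> 1 / 3" using C(3) by linarith
      then have "C * ?r k * (real n / real k + real (Suc d)) \<le> 1 / 3 * (real n / real k + real (Suc d))"
        by (rule mult_right_mono) simp
      also have "\<dots> \<le> 1 / 3 * (real n / 1 + real (Suc d))"
        using k(1) by (intro mult_left_mono add_mono divide_left_mono) auto
      also have "\<dots> \<le> real (Suc d)" by (simp add: n)
      finally have bound: "C * ?r k * (real n / real k + real (Suc d)) \<le> real (Suc d)" .
      show ?thesis
      proof (intro exI[of _ "Suc d"] allI impI)
        fix S :: "nat strategy"
        assume S: "exploration_strategy k S"
        obtain par dep br where "stage k S (Suc (1 * Suc d) + 0) par dep br (Suc d) d {..<1}"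
          using initial_stage[OF S, of "Suc d" d] by blast
        then have T: "stage k S n par dep br (Suc d) d {..<1}" by (simp add: n)
        let ?T = "parent_graph n par"
        have nonempty: "{..<1::nat} \<noteq> {}" by auto
        note T = stage_imp_tree[OF T nonempty]
        have "\<not> explored_after k S ?T s"
          if "real s < C * ?r k * (real n / real k + real (Suc d))" for s
        proof -
          have "s \<le> d" using that bound by linarith
          then show ?thesis using T(3) explored_after_mono by blast
        qed
        with T show "\<exists>T :: nat rooted_graph. rooted_tree T \<and> card (verts T) = n \<and> height T = Suc d \<and>
          needs_at_least_rounds k S T (C * ?r k * (real n / real k + real (Suc d)))"
          unfolding needs_at_least_rounds_def by (intro exI[of _ ?T]) auto
      qed
    qed
  qed
qed

end
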